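(* Let $P\in\mathbb{Z}[x]$ be a monic polynomial of degree $d$ with constant coefficient $\pm1$, let $R$ be the ring of integers of the splitting field $K$ of $P$, let $k$ be an integer, and let $n>1$ be an integer such that $\phi(n)$ is divisible by $\#(R/kR)^\times$. Then $U(n)$ is divisible by $k^d$.
   Context: $\phi$ is Euler's totient function. Let $\alpha_1,\dots,\alpha_d$ be the roots of $P$. For $n>1$ let $\mathcal{D}_+(n)=\{m\mid n:\mu(n/m)=1\}$ and $\mathcal{D}_-(n)=\{m\mid n:\mu(n/m)=-1\}$ ($\mu$ the Möbius function), each with $r=2^{l-1}$ elements when $n$ has $l$ distinct prime factors. For a multiset $\mathcal{N}=\{n_1,\dots,n_r\}$ of positive integers let $P_{\mathcal{N}}(x)=\prod_{j_1,\dots,j_r=1}^d(x-\alpha_{j_1}^{n_1}\cdots\alpha_{j_r}^{n_r})\in\mathbb{Z}[x]$, and $U(n):=\operatorname{Res}(P_{\mathcal{D}_+(n)},P_{\mathcal{D}_-(n)})$, where for monic $A,B$, $\operatorname{Res}(A,B)=\prod_{A(a)=0,B(b)=0}(a-b)$. *)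

theory Defs
  imports
    "HOL-Algebra.Generated_Fields"
    "HOL-Algebra.QuotRing"
    "HOL-Algebra.Algebraic_Closure_Type"
    "HOL-Library.FuncSet"
    "HOL-Library.Multiset"
    "HOL-Computational_Algebra.Computational_Algebra"
    "HOL-Number_Theory.Totient"
begin

abbreviation complex_ring :: "complex ring" where
  "complex_ring \<equiv> ring_of_type_algebra"

text \<open>The splitting field over the rationals, realised inside the complex numbers. The closure
  \<^const>\<open>generate_field\<close> contains \<open>1\<close> and hence all rationals.\<close>

definition splitting_field :: "int poly \<Rightarrow> complex set" where
  "splitting_field P = generate_field complex_ring {z. poly (map_poly of_int P) z = 0}"

definition ring_of_integers :: "complex set \<Rightarrow> complex ring" where
  "ring_of_integers K = complex_ring \<lparr>carrier := {x \<in> K. algebraic_int x}\<rparr>"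

definition quotient_by_int :: "complex ring \<Rightarrow> int \<Rightarrow> complex set ring" where
  "quotient_by_int R k = R Quot (PIdl\<^bsub>R\<^esub> (of_int k))"

definition mobius_mu :: "nat \<Rightarrow> int" where
  "mobius_mu n = (if squarefree n then (-1) ^ card (prime_factors n) else 0)"

definition D_plus :: "nat \<Rightarrow> nat set" where
  "D_plus n = {m. m dvd n \<and> mobius_mu (n div m) = 1}"

definition D_minus :: "nat \<Rightarrow> nat set" where
  "D_minus n = {m. m dvd n \<and> mobius_mu (n div m) = -1}"

text \<open>The factors run over all tuples \<open>(j\<^sub>1, \<dots>, j\<^sub>r)\<close> of indices in \<open>{1..d}\<close>. The tuple positions are
  matched with the elements of the multiset via its sorted enumeration \<open>n\<^sub>1 \<le> \<dots> \<le> n\<^sub>r\<close>; the product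
  does not depend on that choice. If \<open>\<alpha> 1, \<dots>, \<alpha> d\<close> are the roots of a monic integer polynomial, the
  coefficients are integers, although the polynomial is formed over the complex numbers.\<close>

definition power_product_poly :: "nat \<Rightarrow> (nat \<Rightarrow> complex) \<Rightarrow> nat multiset \<Rightarrow> complex poly" where
  "power_product_poly d \<alpha> N =
     (let ns = sorted_list_of_multiset N; r = length ns
      in \<Prod>j\<in>{..<r} \<rightarrow>\<^sub>E {1..d}. [:- (\<Prod>i<r. \<alpha> (j i) ^ (ns ! i)), 1:])"

text \<open>The resultant of two monic polynomials; roots are counted with multiplicity.\<close>

definition monic_resultant :: "complex poly \<Rightarrow> complex poly \<Rightarrow> complex" where
  "monic_resultant A B = (\<Prod>a\<in>#proots A. \<Prod>b\<in>#proots B. a - b)"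

definition U :: "nat \<Rightarrow> (nat \<Rightarrow> complex) \<Rightarrow> nat \<Rightarrow> complex" where
  "U d \<alpha> n = monic_resultant (power_product_poly d \<alpha> (mset_set (D_plus n)))
                             (power_product_poly d \<alpha> (mset_set (D_minus n)))"

end

theory Submission
  imports Defs "Jordan_Normal_Form.Char_Poly"
begin

text \<open>The resultant is a product of differences of algebraic integers. The \<open>d\<close> diagonal factors, in
  which every index of both tuples equals \<open>j\<close>, are \<open>\<alpha>\<^sub>j\<^sup>S (\<alpha>\<^sub>j\<^sup>\<phi> - 1)\<close> with \<open>\<phi> = \<phi>(n)\<close> and \<open>S\<close> the sum of
  \<open>D\<^sub>-(n)\<close>, because \<open>\<Sum>\<mu>(n/m) m = \<phi>(n)\<close>. The roots are units of \<open>R\<close>, so each of these factors is divisible by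
  \<open>k\<close> in \<open>R\<close>, by Lagrange's theorem for the units of \<open>R/kR\<close>. Hence \<open>U(n) = k\<^sup>d w\<close> with an algebraic
  integer \<open>w\<close>, and it remains to see that \<open>U(n)\<close> is rational. In place of symmetric polynomials or Galois
  theory, this uses power sums: by Newton's identities a monic polynomial has rational coefficients
  iff the power sums of its roots are rational, and the latter property is visibly inherited by
  monomials in the roots taken over all index tuples and by differences.\<close>

section \<open>Algebraic integers form a ring\<close>

text \<open>Multiplication by \<open>x\<close> on the span of \<open>S\<close> is described by an
  integer matrix. The vector of the elements of \<open>S\<close> is an eigenvector for
  \<open>x\<close>, nonzero because of \<open>s0\<close>, so \<open>x\<close> is a root of the monic
  integer characteristic polynomial. Linear independence of \<open>S\<close> plays no part in
  this.\<close>

lemma algebraic_int_if_stable: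
  fixes x :: "'a :: field_char_0"
  assumes "finite S" "s0 \<in> S" "s0 \<noteq> 0"
    and stable: "\<And>s. s \<in> S \<Longrightarrow> \<exists>c. x * s = (\<Sum>t\<in>S. of_int (c t) * t)"
  shows "algebraic_int x"
proof -
  obtain C where C: "\<And>s. s \<in> S \<Longrightarrow> x * s = (\<Sum>t\<in>S. of_int (C s t) * t)"
    using stable by metis
  obtain xs where xs: "distinct xs" "set xs = S"
    using finite_distinct_list[OF \<open>finite S\<close>] by blast
  define n where "n = length xs"
  define A :: "int mat" where "A = mat n n (\<lambda>(i, j). C (xs ! i) (xs ! j))"
  define B :: "'a mat" where "B = map_mat of_int A"
  define v where "v = vec n (\<lambda>i. xs ! i)"
  have A: "A \<in> carrier_mat n n" and B: "B \<in> carrier_mat n n"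
    by (simp_all add: A_def B_def)
  have "v \<in> carrier_vec n" by (simp add: v_def)
  moreover have "v \<noteq> 0\<^sub>v n"
  proof -
    obtain i where i: "i < n" "xs ! i = s0"
      using assms(2) xs(2) unfolding n_def by (metis in_set_conv_nth)
    then have "vec_index v i \<noteq> vec_index (0\<^sub>v n) i" using assms(3) by (simp add: v_def)
    then show ?thesis by metis
  qed
  moreover have "B *\<^sub>v v = x \<cdot>\<^sub>v v"
  proof (rule eq_vecI)
    fix i assume "i < dim_vec (x \<cdot>\<^sub>v v)"
    then have i: "i < n" by (simp add: v_def)
    have "vec_index (B *\<^sub>v v) i = (\<Sum>j<n. of_int (C (xs ! i) (xs ! j)) * xs ! j)"
      using i by (simp add: B_def A_def v_def scalar_prod_def atLeast0LessThan)
    also have "\<dots> = (\<Sum>t\<in>S. of_int (C (xs ! i) t) * t)"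
      using xs by (intro sum.reindex_bij_betw bij_betw_nth) (auto simp: n_def)
    also have "\<dots> = vec_index (x \<cdot>\<^sub>v v) i"
      using i xs C[of "xs ! i"] nth_mem[of i xs] by (simp add: v_def n_def)
    finally show "vec_index (B *\<^sub>v v) i = vec_index (x \<cdot>\<^sub>v v) i" .
  qed (simp add: v_def B_def A_def)
  ultimately have "eigenvalue B x"
    using B by (auto simp: eigenvalue_def eigenvector_def)
  then have "poly (map_poly of_int (char_poly A)) x = 0"
    using eigenvalue_root_char_poly[OF B] of_int_hom.char_poly_hom[OF A, where 'a = 'a]
    by (metis B_def)
  moreover have "lead_coeff (char_poly A) = 1"
    using degree_monic_char_poly[OF A] by simp
  ultimately show ?thesis unfolding algebraic_int_altdef_ipoly by blast
qed

text \<open>One coefficient function on all of \<open>S\<close> is used, so that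
  \<open>x * s \<in> int_span S\<close> unfolds to the stability condition of
  \<open>algebraic_int_if_stable\<close>. For finite \<open>S\<close> this is the additive subgroup
  generated by \<open>S\<close>.\<close>

definition int_span :: "'a :: comm_ring_1 set \<Rightarrow> 'a set" where
  "int_span S = {\<Sum>t\<in>S. of_int (c t) * t | c. True}"

lemma int_span_0: "0 \<in> int_span S"
  unfolding int_span_def by (intro CollectI exI[of _ "\<lambda>_. 0"]) simp

lemma int_span_base:
  assumes "finite S" "s \<in> S" shows "s \<in> int_span S"
proof -
  have "(\<Sum>t\<in>S. of_int (if t = s then 1 else 0) * t) = (\<Sum>t\<in>S. if t = s then t else 0)"
    by (intro sum.cong) auto
  also have "\<dots> = s" using assms by simp
  finally show ?thesis
    unfolding int_span_def by (intro CollectI exI[of _ "\<lambda>t. if t = s then 1 else 0"]) simp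
qed

lemma int_span_add:
  assumes "u \<in> int_span S" "v \<in> int_span S" shows "u + v \<in> int_span S"
proof -
  obtain c d where "u = (\<Sum>t\<in>S. of_int (c t) * t)" "v = (\<Sum>t\<in>S. of_int (d t) * t)"
    using assms unfolding int_span_def by blast
  then have "u + v = (\<Sum>t\<in>S. of_int (c t + d t) * t)"
    by (simp add: sum.distrib algebra_simps)
  then show ?thesis unfolding int_span_def by (intro CollectI exI[of _ "\<lambda>t. c t + d t"]) simp
qed

lemma int_span_of_int_mult:
  assumes "u \<in> int_span S" shows "of_int z * u \<in> int_span S"
proof -
  obtain c where "u = (\<Sum>t\<in>S. of_int (c t) * t)"
    using assms unfolding int_span_def by blast
  then have "of_int z * u = (\<Sum>t\<in>S. of_int (z * c t) * t)"
    by (simp add: sum_distrib_left mult.assoc)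
  then show ?thesis unfolding int_span_def by (intro CollectI exI[of _ "\<lambda>t. z * c t"]) simp
qed

lemma int_span_sum:
  assumes "\<And>i. i \<in> I \<Longrightarrow> f i \<in> int_span S" shows "(\<Sum>i\<in>I. f i) \<in> int_span S"
  using assms by (induction I rule: infinite_finite_induct) (auto simp: int_span_0 int_span_add)

text \<open>By linearity, stability is decided on generators. This allows multiplication by
  \<open>a\<close> to be applied after multiplication by \<open>b\<close>.\<close>

lemma int_span_mult_left:
  assumes "\<And>s. s \<in> S \<Longrightarrow> x * s \<in> int_span S" "u \<in> int_span S"
  shows "x * u \<in> int_span S"
proof -
  obtain c where u: "u = (\<Sum>t\<in>S. of_int (c t) * t)"
    using assms unfolding int_span_def by blast
  have "x * u = (\<Sum>t\<in>S. of_int (c t) * (x * t))"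
    by (simp add: u sum_distrib_left mult_ac)
  then show ?thesis using assms(1) by (auto intro!: int_span_sum int_span_of_int_mult)
qed

lemma algebraic_int_power_eq:
  fixes x :: "'a :: field_char_0"
  assumes "algebraic_int x"
  obtains n c where "n > 0" "x ^ n = (\<Sum>i<n. of_int (c i) * x ^ i)"
proof -
  obtain p where p: "poly (map_poly of_int p) x = 0" "lead_coeff p = 1"
    using assms unfolding algebraic_int_altdef_ipoly by blast
  define n where "n = Polynomial.degree p"
  have *: "(\<Sum>i\<le>n. of_int (poly.coeff p i) * x ^ i) = 0"
    using p by (simp add: poly_altdef n_def degree_map_poly coeff_map_poly)
  have "{..n} = insert n {..<n}" by auto
  then have "x ^ n + (\<Sum>i<n. of_int (poly.coeff p i) * x ^ i) = 0"
    using * p(2) by (simp add: n_def)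
  then have eq: "x ^ n = (\<Sum>i<n. of_int (- poly.coeff p i) * x ^ i)"
    by (simp add: sum_negf eq_neg_iff_add_eq_0)
  \<comment> \<open>For \<open>n = 0\<close> the relation would read 1 = 0.\<close>
  moreover have "n > 0" using eq by (intro Nat.gr0I) auto
  ultimately show ?thesis by (intro that[of n "\<lambda>i. - poly.coeff p i"])
qed

text \<open>The generators are the monomials \<open>a ^ i * b ^ j\<close> with both exponents below
  the degrees of monic relations for \<open>a\<close> and \<open>b\<close>. Multiplication raises
  one exponent, and when that reaches the degree, the relation lowers it again. The element 1 serves
  later as the nonzero generator.\<close>

lemma algebraic_int_common_module:
  fixes a b :: "'a :: field_char_0"
  assumes "algebraic_int a" "algebraic_int b"
  obtains S where "finite S" "1 \<in> S"
    "\<And>s. s \<in> S \<Longrightarrow> a * s \<in> int_span S" "\<And>s. s \<in> S \<Longrightarrow> b * s \<in> int_span S"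
proof -
  obtain m c where m: "m > 0" "a ^ m = (\<Sum>i<m. of_int (c i) * a ^ i)"
    using algebraic_int_power_eq[OF assms(1)] by metis
  obtain n d where n: "n > 0" "b ^ n = (\<Sum>i<n. of_int (d i) * b ^ i)"
    using algebraic_int_power_eq[OF assms(2)] by metis
  define S where "S = (\<lambda>(i, j). a ^ i * b ^ j) ` ({..<m} \<times> {..<n})"
  have fin: "finite S" by (simp add: S_def)
  have mem: "a ^ i * b ^ j \<in> int_span S" if "i < m" "j < n" for i j
    using that fin by (intro int_span_base) (auto simp: S_def)
  have "1 \<in> S" using m(1) n(1) by (auto simp: S_def intro!: image_eqI[of _ _ "(0, 0)"])
  moreover have "a * s \<in> int_span S" if "s \<in> S" for s
  proof -
    obtain i j where ij: "i < m" "j < n" "s = a ^ i * b ^ j" using \<open>s \<in> S\<close> by (auto simp: S_def)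
    show ?thesis
    proof (cases "Suc i < m")
      case True
      then show ?thesis using mem[of "Suc i" j] ij by (simp add: mult.assoc)
    next
      case False
      then have "m = Suc i" using ij by simp
      then have "a * s = (\<Sum>i<m. of_int (c i) * (a ^ i * b ^ j))"
        using m(2) ij(3) by (simp add: sum_distrib_right mult.assoc [symmetric] del: sum.lessThan_Suc)
      then show ?thesis using mem ij by (auto intro!: int_span_sum int_span_of_int_mult)
    qed
  qed
  moreover have "b * s \<in> int_span S" if "s \<in> S" for s
  proof -
    obtain i j where ij: "i < m" "j < n" "s = a ^ i * b ^ j" using \<open>s \<in> S\<close> by (auto simp: S_def)
    show ?thesis
    proof (cases "Suc j < n")
      case True
      then show ?thesis using mem[of i "Suc j"] ij by (simp add: mult_ac)
    next
      case False
      then have "n = Suc j" using ij by simp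
      then have "b * s = a ^ i * b ^ n" using ij(3) by (simp add: mult_ac)
      also have "\<dots> = (\<Sum>j<n. of_int (d j) * (a ^ i * b ^ j))"
        by (simp add: n(2) sum_distrib_left mult_ac)
      finally show ?thesis using mem ij by (auto intro!: int_span_sum int_span_of_int_mult)
    qed
  qed
  ultimately show ?thesis using that fin by blast
qed

text \<open>A module stable under \<open>a\<close> and \<open>b\<close> is stable under their sum
  and product.\<close>

lemma algebraic_int_add_mult:
  fixes a b :: "'a :: field_char_0"
  assumes "algebraic_int a" "algebraic_int b"
  shows algebraic_int_add: "algebraic_int (a + b)"
    and algebraic_int_mult: "algebraic_int (a * b)"
proof -
  obtain S where S: "finite S" "1 \<in> S"
    "\<And>s. s \<in> S \<Longrightarrow> a * s \<in> int_span S" "\<And>s. s \<in> S \<Longrightarrow> b * s \<in> int_span S"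
    using algebraic_int_common_module[OF assms] by metis
  have "(a + b) * s \<in> int_span S" if "s \<in> S" for s
    using S(3,4)[OF that] by (simp add: distrib_right int_span_add)
  moreover have "(a * b) * s \<in> int_span S" if "s \<in> S" for s
    using int_span_mult_left[OF S(3) S(4)[OF that]] by (simp add: mult.assoc)
  ultimately show "algebraic_int (a + b)" "algebraic_int (a * b)"
    using S(1,2) unfolding int_span_def by (auto intro!: algebraic_int_if_stable[of S 1])
qed

lemma algebraic_int_diff:
  fixes a b :: "'a :: field_char_0"
  shows "algebraic_int a \<Longrightarrow> algebraic_int b \<Longrightarrow> algebraic_int (a - b)"
  using algebraic_int_add[of a "- b"] by auto

lemma algebraic_int_prod:
  fixes f :: "'i \<Rightarrow> 'a :: field_char_0"
  assumes "\<And>i. i \<in> I \<Longrightarrow> algebraic_int (f i)"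
  shows "algebraic_int (\<Prod>i\<in>I. f i)"
  using assms
  by (induction I rule: infinite_finite_induct)
    (simp_all add: algebraic_int_mult int_imp_algebraic_int)

lemma algebraic_int_power:
  fixes a :: "'a :: field_char_0"
  shows "algebraic_int a \<Longrightarrow> algebraic_int (a ^ n)"
  using algebraic_int_prod[of "{..<n}" "\<lambda>_. a"] by simp

section \<open>Newton's identities\<close>

text \<open>The logarithmic derivative of \<open>\<Prod>(1 - c\<^sub>i X)\<close> is minus the generating function of the power
  sums of the \<open>c\<^sub>i\<close>; comparing coefficients yields Newton's identities.\<close>

lemma fps_deriv_prod_one_minus:
  fixes c :: "'i \<Rightarrow> 'a :: field_char_0"
  assumes "finite I"
  shows "fps_deriv (\<Prod>i\<in>I. 1 - fps_const (c i) * fps_X) =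
    - ((\<Prod>i\<in>I. 1 - fps_const (c i) * fps_X) * Abs_fps (\<lambda>k. \<Sum>i\<in>I. c i ^ Suc k))"
  using assms
proof (induction I rule: finite_induct)
  case empty
  then show ?case by (simp add: fps_eq_iff)
next
  case (insert a I)
  let ?L = "1 - fps_const (c a) * fps_X :: 'a fps"
  let ?Q = "\<Prod>i\<in>I. 1 - fps_const (c i) * fps_X"
  let ?G = "Abs_fps (\<lambda>k. c a ^ Suc k)" and ?S = "Abs_fps (\<lambda>k. \<Sum>i\<in>I. c i ^ Suc k)"
  \<comment> \<open>Geometric series: \<open>?G\<close> is \<open>c a\<close> divided by
    \<open>?L\<close>.\<close>
  have G: "?L * ?G = fps_const (c a)"
  proof (rule fps_ext)
    fix n show "fps_nth (?L * ?G) n = fps_nth (fps_const (c a)) n"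
      by (cases n) (simp_all add: algebra_simps)
  qed
  have distr: "- (l * (q * s)) - (l * g) * q = - ((l * q) * (g + s))" for l q s g :: "'a fps"
    by (simp add: algebra_simps)
  have "Abs_fps (\<lambda>k. \<Sum>i\<in>insert a I. c i ^ Suc k) = ?G + ?S"
    using insert by (simp add: fps_eq_iff)
  moreover have "fps_deriv (?L * ?Q) = - ((?L * ?Q) * (?G + ?S))"
  proof -
    have "fps_deriv (?L * ?Q) = - (?L * (?Q * ?S)) - fps_const (c a) * ?Q"
      by (simp add: insert.IH flip: fps_const_neg)
    also have "\<dots> = - ((?L * ?Q) * (?G + ?S))"
      using G distr[of ?L ?Q ?S ?G] by simp
    finally show ?thesis .
  qed
  ultimately show ?case using insert by simp
qed

text \<open>Up to the sign (-1)^n, \<open>q n\<close> is the elementary symmetric polynomial of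
  degree n in the \<open>c i\<close>; it vanishes for n beyond \<open>card I\<close>.\<close>

lemma newton_identity:
  fixes c :: "'i \<Rightarrow> 'a :: field_char_0"
  assumes "finite I"
  defines "q \<equiv> \<lambda>n. poly.coeff (\<Prod>i\<in>I. [:1, - c i:]) n"
  shows "of_nat (Suc n) * q (Suc n) = - (\<Sum>j\<le>n. q j * (\<Sum>i\<in>I. c i ^ Suc (n - j)))"
proof -
  let ?Q = "\<Prod>i\<in>I. 1 - fps_const (c i) * fps_X"
  have "fps_of_poly (\<Prod>i\<in>I. [:1, - c i:]) = ?Q"
    by (simp add: fps_of_poly_prod fps_of_poly_linear' flip: fps_const_neg)
  then have q: "fps_nth ?Q n = q n" for n
    unfolding q_def by (metis fps_of_poly_nth)
  have "fps_nth (fps_deriv ?Q) n = - (\<Sum>j\<le>n. fps_nth ?Q j * (\<Sum>i\<in>I. c i ^ Suc (n - j)))"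
    by (simp only: fps_deriv_prod_one_minus[OF assms(1)] fps_neg_nth fps_mult_nth atLeast0AtMost
        fps_nth_Abs_fps)
  then show ?thesis by (simp add: q del: of_nat_Suc power_Suc)
qed

text \<open>Links the polynomial with roots \<open>c i\<close> to the product in Newton's
  identities: both have the same coefficients, in opposite order.\<close>

lemma reflect_prod_linear:
  fixes c :: "'i \<Rightarrow> 'a :: field_char_0"
  shows "reflect_poly (\<Prod>i\<in>I. [:- c i, 1:]) = (\<Prod>i\<in>I. [:1, - c i:])"
proof -
  have "reflect_poly [:- c i, 1:] = [:1, - c i:]" for i
    by (simp add: reflect_poly_def)
  then show ?thesis by (simp add: reflect_poly_prod)
qed

lemma power_sums_Rats:
  fixes c :: "'i \<Rightarrow> 'a :: field_char_0"
  assumes "finite I" and coeffs: "\<And>k. poly.coeff (\<Prod>i\<in>I. [:- c i, 1:]) k \<in> \<rat>"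
  shows "(\<Sum>i\<in>I. c i ^ k) \<in> \<rat>"
proof (induction k rule: less_induct)
  case (less k)
  define q where "q = (\<lambda>n. poly.coeff (\<Prod>i\<in>I. [:1, - c i:]) n)"
  have q: "q n \<in> \<rat>" for n
    unfolding q_def by (simp add: coeffs coeff_reflect_poly flip: reflect_prod_linear)
  have "q 0 = 1"
    unfolding q_def by (simp add: poly_prod flip: poly_0_coeff_0)
  show ?case
  proof (cases k)
    case 0
    then show ?thesis by simp
  next
    case (Suc n)
    let ?p = "\<lambda>j. \<Sum>i\<in>I. c i ^ Suc (n - j)"
    \<comment> \<open>The term for index 0 is the power sum with exponent \<open>k = Suc n\<close>,
      with coefficient \<open>q 0 = 1\<close>; all other terms involve smaller exponents.\<close>
    have "{..n} = insert 0 {1..n}" by auto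
    then have "(\<Sum>j\<le>n. q j * ?p j) = ?p 0 + (\<Sum>j=1..n. q j * ?p j)"
      using \<open>q 0 = 1\<close> by simp
    then have "?p 0 = - (of_nat (Suc n) * q (Suc n)) - (\<Sum>j=1..n. q j * ?p j)"
      by (simp only: newton_identity[OF assms(1), of n c, folded q_def] minus_minus
          add_diff_cancel_right')
    also have "\<dots> \<in> \<rat>"
    proof -
      have "q j * ?p j \<in> \<rat>" if "j \<in> {1..n}" for j
        using q less.IH[of "Suc (n - j)"] Suc that by (simp del: power_Suc)
      then show ?thesis
        using q Rats_sum[of "{1..n}" "\<lambda>j. q j * ?p j"] by (simp del: power_Suc of_nat_Suc)
    qed
    finally show ?thesis using Suc by simp
  qed
qed

text \<open>Newton's identities, divided by \<open>Suc n\<close>, now determine the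
  \<open>q n\<close> from the power sums. The product of the \<open>c i\<close> is the last of them
  up to sign.\<close>

lemma prod_Rats_of_power_sums:
  fixes c :: "'i \<Rightarrow> 'a :: field_char_0"
  assumes "finite I" and sums: "\<And>k. (\<Sum>i\<in>I. c i ^ k) \<in> \<rat>"
  shows "(\<Prod>i\<in>I. c i) \<in> \<rat>"
proof -
  define q where "q = (\<lambda>n. poly.coeff (\<Prod>i\<in>I. [:1, - c i:]) n)"
  have q: "q k \<in> \<rat>" for k
  proof (induction k rule: less_induct)
    case (less k)
    show ?case
    proof (cases k)
      case 0
      then show ?thesis unfolding q_def by (simp add: poly_prod flip: poly_0_coeff_0)
    next
      case (Suc n)
      have "of_nat (Suc n) * q (Suc n) \<in> \<rat>"
        unfolding newton_identity[OF assms(1), of n c, folded q_def]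
        using less.IH Suc sums
        by (intro Rats_minus_iff [THEN iffD2] Rats_sum[of "{..n}"] Rats_mult) (simp_all del: power_Suc)
      then have "of_nat (Suc n) * q (Suc n) / of_nat (Suc n) \<in> \<rat>"
        by (intro Rats_divide Rats_of_nat)
      then show ?thesis using Suc by (simp del: of_nat_Suc)
    qed
  qed
  \<comment> \<open>The degree fixes the index to which reversal moves the constant
    coefficient.\<close>
  have deg: "Polynomial.degree (\<Prod>i\<in>I. [:- c i, 1:]) = card I"
    by (subst degree_prod_sum_eq) auto
  have "q (card I) = poly.coeff (\<Prod>i\<in>I. [:- c i, 1:]) 0"
    by (simp add: q_def deg coeff_reflect_poly flip: reflect_prod_linear)
  also have "\<dots> = (-1) ^ card I * (\<Prod>i\<in>I. c i)"
    by (simp add: poly_prod flip: poly_0_coeff_0 prod_uminus)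
  finally have "(\<Prod>i\<in>I. c i) = (-1) ^ card I * q (card I)"
    by (simp flip: power_add mult.assoc)
  then show ?thesis using q by auto
qed

text \<open>The binomial theorem turns the left side into a rational combination of products of a
  power sum of \<open>a\<close> and one of \<open>b\<close>.\<close>

lemma power_sums_diff_Rats:
  fixes a :: "'i \<Rightarrow> 'a :: field_char_0" and b :: "'j \<Rightarrow> 'a"
  assumes "\<And>k. (\<Sum>i\<in>I. a i ^ k) \<in> \<rat>" "\<And>k. (\<Sum>j\<in>J. b j ^ k) \<in> \<rat>"
  shows "(\<Sum>(i, j)\<in>I \<times> J. (a i - b j) ^ k) \<in> \<rat>"
proof -
  have "(\<Sum>(i, j)\<in>I \<times> J. (a i - b j) ^ k) = (\<Sum>i\<in>I. \<Sum>j\<in>J. (a i + (- b j)) ^ k)"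
    by (simp add: sum.cartesian_product)
  also have "\<dots> = (\<Sum>i\<in>I. \<Sum>j\<in>J. \<Sum>l\<le>k. of_nat (k choose l) * a i ^ l * (- b j) ^ (k - l))"
    by (simp only: binomial_ring)
  also have "\<dots> = (\<Sum>i\<in>I. \<Sum>l\<le>k. \<Sum>j\<in>J. of_nat (k choose l) * a i ^ l * (- b j) ^ (k - l))"
    by (intro sum.cong refl sum.swap)
  also have "\<dots> = (\<Sum>l\<le>k. \<Sum>i\<in>I. \<Sum>j\<in>J. of_nat (k choose l) * a i ^ l * (- b j) ^ (k - l))"
    by (rule sum.swap)
  also have "\<dots> = (\<Sum>l\<le>k. of_nat (k choose l) * (-1) ^ (k - l) *
      ((\<Sum>i\<in>I. a i ^ l) * (\<Sum>j\<in>J. b j ^ (k - l))))"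
  proof (rule sum.cong)
    fix l
    have "(\<Sum>i\<in>I. \<Sum>j\<in>J. of_nat (k choose l) * a i ^ l * (- b j) ^ (k - l)) =
        (\<Sum>i\<in>I. \<Sum>j\<in>J. of_nat (k choose l) * (-1) ^ (k - l) * (a i ^ l * b j ^ (k - l)))"
      by (simp add: mult_ac power_minus[of "b _"])
    then show "(\<Sum>i\<in>I. \<Sum>j\<in>J. of_nat (k choose l) * a i ^ l * (- b j) ^ (k - l)) =
        of_nat (k choose l) * (-1) ^ (k - l) * ((\<Sum>i\<in>I. a i ^ l) * (\<Sum>j\<in>J. b j ^ (k - l)))"
      by (simp only: sum_product) (simp only: sum_distrib_left)
  qed simp
  also have "\<dots> \<in> \<rat>"
    by (rule Rats_sum) (simp add: assms)
  finally show ?thesis .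
qed

section \<open>The divisor sum of the totient\<close>

lemma mobius_mu_eq_1_iff: "mobius_mu q = 1 \<longleftrightarrow> squarefree q \<and> even (card (prime_factors q))"
  by (simp add: mobius_mu_def minus_one_power_iff)

lemma mobius_mu_eq_minus_1_iff:
  "mobius_mu q = -1 \<longleftrightarrow> squarefree q \<and> odd (card (prime_factors q))"
  by (simp add: mobius_mu_def minus_one_power_iff)

text \<open>With \<open>prod_prime_factors_squarefree\<close>, this makes products of primes a
  bijection from the subsets of \<open>prime_factors n\<close> to the squarefree divisors of
  \<open>n\<close>.\<close>

lemma prod_prime_subset:
  fixes n :: nat
  assumes "n > 0" "A \<subseteq> prime_factors n"
  shows "(\<Prod>p\<in>A. p) dvd n" "squarefree (\<Prod>p\<in>A. p)" "prime_factors (\<Prod>p\<in>A. p) = A" "(\<Prod>p\<in>A. p) > 0"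
proof -
  have fin: "finite A" using assms(2) finite_subset by blast
  have pr: "prime p" "p dvd n" if "p \<in> A" for p using assms(2) that by auto
  show pos: "(\<Prod>p\<in>A. p) > 0" using pr by (intro prod_pos) (auto simp: prime_gt_0_nat)
  show "(\<Prod>p\<in>A. p) dvd n"
  proof -
    have "(\<Prod>p\<in>A. p) dvd (\<Prod>p\<in>prime_factors n. p)"
      using assms(2) by (intro prod_dvd_prod_subset) auto
    also have "\<dots> dvd (\<Prod>p\<in>prime_factors n. p ^ multiplicity p n)"
      by (intro prod_dvd_prod) (auto simp: prime_factors_multiplicity intro: dvd_power)
    also have "\<dots> = n"
      using assms(1) by (simp flip: prime_factorization_nat)
    finally show ?thesis .
  qed
  show "squarefree (\<Prod>p\<in>A. p)"
    using pr by (intro squarefree_prod_coprime) (auto intro: primes_coprime squarefree_prime)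
  show "prime_factors (\<Prod>p\<in>A. p) = A"
  proof (rule Set.set_eqI)
    fix p
    have "p \<in> prime_factors (\<Prod>p\<in>A. p) \<longleftrightarrow> prime p \<and> p dvd (\<Prod>p\<in>A. p)"
      using pos by (simp only: in_prime_factors_iff) auto
    also have "\<dots> \<longleftrightarrow> prime p \<and> (\<exists>q\<in>A. p dvd q)"
      using fin by (auto simp: prime_dvd_prod_iff)
    also have "\<dots> \<longleftrightarrow> p \<in> A"
      using pr by (metis dvd_refl primes_dvd_imp_eq)
    finally show "p \<in> prime_factors (\<Prod>p\<in>A. p) \<longleftrightarrow> p \<in> A" .
  qed
qed

lemma prod_prime_factors_squarefree:
  fixes q :: nat
  assumes "squarefree q"
  shows "(\<Prod>p\<in>prime_factors q. p) = q"
proof -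
  have "q > 0" using assms by (cases "q = 0") auto
  then have "q = (\<Prod>p\<in>prime_factors q. p ^ multiplicity p q)"
    by (rule prime_factorization_nat)
  also have "\<dots> = (\<Prod>p\<in>prime_factors q. p)"
  proof (rule prod.cong)
    fix p assume "p \<in> prime_factors q"
    then have "prime p" "multiplicity p q > 0" by (simp_all add: prime_factors_multiplicity)
    moreover have "multiplicity p q \<le> 1"
      using assms \<open>prime p\<close> \<open>q > 0\<close> by (simp add: squarefree_factorial_semiring'')
    ultimately have "multiplicity p q = 1" by linarith
    then show "p ^ multiplicity p q = p" by simp
  qed simp
  finally show ?thesis by simp
qed

text \<open>Expanding Euler's product n * prod (1 - 1/p) over sets of primes gives a signed sum of
  the quotients of \<open>n\<close> by squarefree divisors. Sets of even size yield
  \<open>D_plus n\<close>, those of odd size \<open>D_minus n\<close>. The additive form avoids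
  truncated subtraction.\<close>

lemma totient_eq_sum_D:
  assumes "n > 0"
  shows "(\<Sum>m\<in>D_plus n. m) = (\<Sum>m\<in>D_minus n. m) + totient n"
proof -
  let ?P = "prime_factors n"
  have div_div: "n div (n div q) = q" if "q dvd n" for q
    using that assms by (auto elim!: dvdE)
  have sub: "p \<in> ?P" if "p \<in> prime_factors (n div m)" "m dvd n" for p m
    using that assms dvd_prime_factors[of n "n div m"] by (auto elim!: dvdE)
  have plus: "(\<Sum>A | A \<subseteq> ?P \<and> even (card A). real (n div (\<Prod>p\<in>A. p))) = real (\<Sum>m\<in>D_plus n. m)"
    unfolding of_nat_sum
    by (rule sum.reindex_bij_witness[of _ "\<lambda>m. prime_factors (n div m)" "\<lambda>A. n div (\<Prod>p\<in>A. p)"])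
      (use assms in \<open>auto simp: D_plus_def mobius_mu_eq_1_iff prod_prime_subset div_div
        prod_prime_factors_squarefree div_dvd_iff_mult dest: sub\<close>)
  have minus: "(\<Sum>A | A \<subseteq> ?P \<and> odd (card A). real (n div (\<Prod>p\<in>A. p))) = real (\<Sum>m\<in>D_minus n. m)"
    unfolding of_nat_sum
    by (rule sum.reindex_bij_witness[of _ "\<lambda>m. prime_factors (n div m)" "\<lambda>A. n div (\<Prod>p\<in>A. p)"])
      (use assms in \<open>auto simp: D_minus_def mobius_mu_eq_minus_1_iff prod_prime_subset div_div
        prod_prime_factors_squarefree div_dvd_iff_mult dest: sub\<close>)
  \<comment> \<open>With the summands in this order, the set \<open>A\<close> in the expansion
    consists of the primes contributing -1/p; the others contribute 1.\<close>
  have "real (totient n) = real n * (\<Prod>p\<in>?P. - (1 / real p) + 1)"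
    by (simp add: totient_formula2)
  also have "\<dots> = (\<Sum>A\<in>Pow ?P. real n * (\<Prod>p\<in>A. - (1 / real p)))"
    by (simp only: prod_add[OF finite_set_mset] sum_distrib_left prod.neutral_const mult_1_right)
  also have "\<dots> = (\<Sum>A\<in>Pow ?P. (-1) ^ card A * real (n div (\<Prod>p\<in>A. p)))"
  proof (rule sum.cong)
    fix A assume "A \<in> Pow ?P"
    then have "A \<subseteq> ?P" by simp
    from prod_prime_subset(1)[OF assms this]
    show "real n * (\<Prod>p\<in>A. - (1 / real p)) = (-1) ^ card A * real (n div (\<Prod>p\<in>A. p))"
      by (simp add: prod_uminus prod_dividef real_of_nat_div)
  qed simp
  also have "Pow ?P = {A. A \<subseteq> ?P \<and> even (card A)} \<union> {A. A \<subseteq> ?P \<and> odd (card A)}"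
    by auto
  also have "(\<Sum>A\<in>\<dots>. (-1) ^ card A * real (n div (\<Prod>p\<in>A. p))) =
      (\<Sum>A | A \<subseteq> ?P \<and> even (card A). (-1) ^ card A * real (n div (\<Prod>p\<in>A. p))) +
      (\<Sum>A | A \<subseteq> ?P \<and> odd (card A). (-1) ^ card A * real (n div (\<Prod>p\<in>A. p)))"
    by (rule sum.union_disjoint) (auto intro: finite_subset[of _ "Pow ?P"])
  also have "\<dots> = (\<Sum>A | A \<subseteq> ?P \<and> even (card A). real (n div (\<Prod>p\<in>A. p))) -
      (\<Sum>A | A \<subseteq> ?P \<and> odd (card A). real (n div (\<Prod>p\<in>A. p)))"
    by (simp add: sum_negf)
  finally show ?thesis unfolding plus minus by linarith
qed

section \<open>Units modulo an integer and the resultant\<close>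

lemma proots_prod_linear:
  fixes a :: "'i \<Rightarrow> 'a :: field_char_0"
  shows "finite I \<Longrightarrow> proots (\<Prod>i\<in>I. [:- a i, 1:]) = image_mset a (mset_set I)"
  by (induction I rule: finite_induct) (simp_all add: proots_mult prod_zero_iff del: mult_pCons_left)

text \<open>Indices replace the root multisets, so equal roots remain separate factors and the
  diagonal ones can be selected by index.\<close>

lemma monic_resultant_prod_linear:
  assumes "finite I" "finite J"
  shows "monic_resultant (\<Prod>i\<in>I. [:- a i, 1:]) (\<Prod>j\<in>J. [:- b j, 1:]) =
    (\<Prod>(i, j)\<in>I \<times> J. a i - b j)"
  using assms
  by (simp add: monic_resultant_def proots_prod_linear multiset.map_comp comp_def
      prod.cartesian_product flip: prod_unfold_prod_mset)

section \<open>Algebraic integers in a subring of the complex numbers, and their units modulo an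
  integer\<close>

lemma complex_ring_simps:
  "carrier complex_ring = UNIV" "x \<otimes>\<^bsub>complex_ring\<^esub> y = x * y" "\<one>\<^bsub>complex_ring\<^esub> = 1"
  "x \<oplus>\<^bsub>complex_ring\<^esub> y = x + y" "\<zero>\<^bsub>complex_ring\<^esub> = 0" "\<ominus>\<^bsub>complex_ring\<^esub> x = - x"
proof -
  interpret cring complex_ring by (rule cring_from_type_algebra)
  show simps: "carrier complex_ring = UNIV" "x \<otimes>\<^bsub>complex_ring\<^esub> y = x * y" "\<one>\<^bsub>complex_ring\<^esub> = 1"
    "x \<oplus>\<^bsub>complex_ring\<^esub> y = x + y" "\<zero>\<^bsub>complex_ring\<^esub> = 0" for x y
    by (simp_all add: ring_of_type_algebra_def)
  show "\<ominus>\<^bsub>complex_ring\<^esub> x = - x"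
    by (rule minus_equality) (simp_all add: simps)
qed

lemma complex_ring_inv:
  assumes "x \<noteq> 0" shows "inv\<^bsub>complex_ring\<^esub> x = inverse x"
proof -
  interpret cring complex_ring by (rule cring_from_type_algebra)
  show ?thesis by (rule comm_inv_char) (use assms in \<open>simp_all add: complex_ring_simps\<close>)
qed

lemma subring_algebraic_ints:
  assumes "subring K complex_ring"
  shows "subring {x \<in> K. algebraic_int x} complex_ring"
proof -
  interpret cring complex_ring by (rule cring_from_type_algebra)
  show ?thesis
    using subringE[OF assms, unfolded complex_ring_simps]
    by (intro subringI)
      (auto simp: complex_ring_simps intro: algebraic_int_add algebraic_int_mult int_imp_algebraic_int)
qed

lemma subring_of_int_closed:
  assumes "subring K complex_ring"
  shows "of_int k \<in> K"
proof -
  note cl = subringE[OF assms, unfolded complex_ring_simps]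
  have nat: "of_nat n \<in> K" for n
    by (induction n) (auto intro: cl)
  show ?thesis
    by (cases k rule: int_cases2) (auto intro: nat cl)
qed

text \<open>The class of \<open>x\<close> is a unit of the quotient, with the class of
  \<open>inverse x\<close> as its inverse, so Lagrange's theorem makes its \<open>m\<close>-th power
  1.\<close>

lemma power_cong_1_ring_of_integers:
  assumes K: "subring K complex_ring"
    and x: "x \<in> K" "inverse x \<in> K" "algebraic_int x" "algebraic_int (inverse x)" "x \<noteq> 0"
    and card: "card (Units (quotient_by_int (ring_of_integers K) k)) dvd m" and "m > 0"
  obtains r where "algebraic_int r" "x ^ m - 1 = of_int k * r"
proof -
  define R where "R = ring_of_integers K"
  interpret C: cring complex_ring by (rule cring_from_type_algebra)
  interpret R: cring R
    using C.subcringI'[OF subring_algebraic_ints[OF K]] C.subcring_iff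
    by (simp add: R_def ring_of_integers_def complex_ring_simps)
  have R_simps: "carrier R = {x \<in> K. algebraic_int x}" "y \<otimes>\<^bsub>R\<^esub> z = y * z" "\<one>\<^bsub>R\<^esub> = 1"
    "y \<oplus>\<^bsub>R\<^esub> z = y + z" for y z
    by (simp_all add: R_def ring_of_integers_def complex_ring_simps)
  have R_pow: "y [^]\<^bsub>R\<^esub> n = y ^ n" for y and n :: nat
    by (induction n) (simp_all add: R_simps)
  define I where "I = PIdl\<^bsub>R\<^esub> (of_int k)"
  define Q where "Q = R Quot I"
  have "of_int k \<in> carrier R"
    using subring_of_int_closed[OF K] by (simp add: R_simps int_imp_algebraic_int)
  then interpret I: ideal I R
    unfolding I_def by (rule R.cgenideal_ideal)
  interpret h: ring_hom_cring R Q "(+>\<^bsub>R\<^esub>) I"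
    unfolding Q_def by (rule I.rcos_ring_hom_cring) (rule R.is_cring)
  let ?h = "(+>\<^bsub>R\<^esub>) I"
  have xR: "x \<in> carrier R" "inverse x \<in> carrier R" using x by (simp_all add: R_simps)
  have "?h x \<otimes>\<^bsub>Q\<^esub> ?h (inverse x) = \<one>\<^bsub>Q\<^esub>"
    using h.hom_mult[OF xR] \<open>x \<noteq> 0\<close> h.hom_one by (simp add: R_simps)
  moreover have hR: "?h x \<in> carrier Q" "?h (inverse x) \<in> carrier Q"
    using xR by (simp_all only: h.hom_closed)
  ultimately have unit: "?h x \<in> Units Q"
    using h.S.m_comm[OF hR] unfolding Units_def by auto
  have card_dvd: "card (Units Q) dvd m"
    using card by (simp add: quotient_by_int_def Q_def I_def R_def)
  \<comment> \<open>An infinite set has cardinality 0, and 0 divides no positive \<open>m\<close>;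
    hence the unit group is finite.\<close>
  then have "card (Units Q) \<noteq> 0" using \<open>m > 0\<close> by (intro notI) simp
  then have "finite (Units Q)" by (rule card_ge_0_finite[OF Nat.neq0_conv[THEN iffD1]])
  then have ord: "?h x [^]\<^bsub>Q\<^esub> card (Units Q) = \<one>\<^bsub>Q\<^esub>"
    using unit by (rule h.S.units_power_order_eq_one)
  obtain c where "m = card (Units Q) * c" using card_dvd by blast
  then have "?h x [^]\<^bsub>Q\<^esub> m = \<one>\<^bsub>Q\<^esub>"
    using ord h.S.nat_pow_pow[OF hR(1), of "card (Units Q)" c] by simp
  then have "?h (x ^ m) = ?h 1"
    using ring_hom_ring.hom_nat_pow[OF I.rcos_ring_hom_ring xR(1), of m, folded Q_def] h.hom_one by (simp add: R_pow R_simps)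
  moreover have "x ^ m \<in> carrier R"
    using R.nat_pow_closed[OF xR(1), of m] by (simp add: R_pow)
  ultimately have "x ^ m \<in> I +>\<^bsub>R\<^esub> 1"
    using I.a_rcos_self by metis
  then obtain i where "i \<in> I" "x ^ m = i + 1"
    by (auto simp: a_r_coset_def' R_simps)
  then show ?thesis
    using that by (auto simp: I_def cgenideal_def R_simps mult.commute)
qed


section \<open>Monomials in the roots over index tuples\<close>

text \<open>Taking \<open>k\<close>-th powers only rescales the exponents \<open>e i\<close>; by
  distributivity the sum over tuples is then a product of power sums, one for each position.\<close>

lemma power_sums_tuples_Rats:
  fixes \<alpha> :: "'i \<Rightarrow> 'a :: field_char_0" and e :: "nat \<Rightarrow> nat"
  assumes "finite J" and sums: "\<And>k. (\<Sum>j\<in>J. \<alpha> j ^ k) \<in> \<rat>"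
  shows "(\<Sum>f\<in>{..<r} \<rightarrow>\<^sub>E J. (\<Prod>i<r. \<alpha> (f i) ^ e i) ^ k) \<in> \<rat>"
proof -
  have "(\<Sum>f\<in>{..<r} \<rightarrow>\<^sub>E J. (\<Prod>i<r. \<alpha> (f i) ^ e i) ^ k) =
      (\<Sum>f\<in>{..<r} \<rightarrow>\<^sub>E J. \<Prod>i<r. \<alpha> (f i) ^ (e i * k))"
    by (simp add: power_mult flip: prod_power_distrib)
  also have "\<dots> = (\<Prod>i<r. \<Sum>j\<in>J. \<alpha> j ^ (e i * k))"
    using assms(1) by (subst prod_sum_PiE) auto
  also have "\<dots> \<in> \<rat>"
    using sums by (intro Rats_prod)
  finally show ?thesis .
qed

text \<open>Evaluates the monomial of a constant index tuple, as needed for the diagonal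
  factors.\<close>

lemma prod_power_nth_sorted:
  fixes x :: "'a :: comm_semiring_1"
  assumes "finite A"
  defines "ns \<equiv> sorted_list_of_multiset (mset_set A)"
  shows "(\<Prod>i<length ns. x ^ (ns ! i)) = x ^ (\<Sum>m\<in>A. m)"
proof -
  have "(\<Sum>i<length ns. ns ! i) = sum_list ns"
    by (simp add: sum_list_sum_nth atLeast0LessThan)
  also have "\<dots> = sum_mset (mset_set A)"
    by (simp only: ns_def mset_sorted_list_of_multiset flip: sum_mset_sum_list)
  also have "\<dots> = (\<Sum>m\<in>A. m)"
    by (simp add: sum_unfold_sum_mset)
  finally show ?thesis by (simp flip: power_sum)
qed

section \<open>Integrality and divisibility of the resultant\<close>

theorem theorem8p16:
  fixes P :: "int poly" and d :: nat and \<alpha> :: "nat \<Rightarrow> complex"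
    and R :: "complex ring" and k :: int and n :: nat
  assumes "lead_coeff P = 1" and "Polynomial.degree P = d"
    and "Polynomial.coeff P 0 = 1 \<or> Polynomial.coeff P 0 = -1"
    and "map_poly of_int P = (\<Prod>j\<in>{1..d}. [:- \<alpha> j, 1:])"
    and "R = ring_of_integers (splitting_field P)"
    and "n > 1"
    and "card (Units (quotient_by_int R k)) dvd totient n"
  shows "\<exists>u::int. U d \<alpha> n = of_int u \<and> k ^ d dvd u"
proof -
  let ?K = "splitting_field P" and ?p = "map_poly of_int P :: complex poly"
  interpret C: field complex_ring by (rule field_from_type_algebra)
  have K: "subring ?K complex_ring"
    unfolding splitting_field_def
    by (intro subfieldE(1) C.generate_field_is_subfield) (simp add: complex_ring_simps)
  have root: "poly ?p (\<alpha> j) = 0" if "j \<in> {1..d}" for j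
    using that by (auto simp: assms(4) poly_prod)
  have nz: "\<alpha> j \<noteq> 0" if "j \<in> {1..d}" for j
    using root[OF that] assms(3) by (auto simp: poly_0_coeff_0 coeff_map_poly)
  have int: "algebraic_int (\<alpha> j)" if "j \<in> {1..d}" for j
    using root[OF that] assms(1) unfolding algebraic_int_altdef_ipoly by blast
  \<comment> \<open>The inverse is a root of the reversed polynomial, which is monic when the
    constant coefficient is 1; for -1 the polynomial is negated first.\<close>
  have int_inverse: "algebraic_int (inverse (\<alpha> j))" if "j \<in> {1..d}" for j
    using assms(3)
  proof
    assume "poly.coeff P 0 = 1"
    then show ?thesis
      using root[OF that] by (intro algebraic_int_inverse[of ?p]) (auto simp: coeff_map_poly)
  next
    assume "poly.coeff P 0 = -1"
    then show ?thesis
      using root[OF that] by (intro algebraic_int_inverse[of "- ?p"]) (auto simp: coeff_map_poly)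
  qed
  have inK: "\<alpha> j \<in> ?K" "inverse (\<alpha> j) \<in> ?K" if "j \<in> {1..d}" for j
  proof -
    show *: "\<alpha> j \<in> ?K"
      unfolding splitting_field_def using root[OF that] by (intro generate_field.incl) simp
    show "inverse (\<alpha> j) \<in> ?K"
      using generate_field.m_inv[OF *[unfolded splitting_field_def]] nz[OF that]
      by (simp add: splitting_field_def complex_ring_simps complex_ring_inv)
  qed
  have "\<exists>\<rho>. algebraic_int \<rho> \<and> \<alpha> j ^ totient n - 1 = of_int k * \<rho>" if "j \<in> {1..d}" for j
  proof -
    have "totient n > 0" using assms(6) by simp
    from power_cong_1_ring_of_integers[OF K inK[OF that] int[OF that] int_inverse[OF that] nz[OF that]
        assms(7)[unfolded assms(5)] this]
    show ?thesis by metis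
  qed
  then obtain \<rho> where \<rho>: "\<And>j. j \<in> {1..d} \<Longrightarrow> algebraic_int (\<rho> j)"
    "\<And>j. j \<in> {1..d} \<Longrightarrow> \<alpha> j ^ totient n - 1 = of_int k * \<rho> j"
    by metis

  define ns where "ns = sorted_list_of_multiset (mset_set (D_plus n))"
  define ms where "ms = sorted_list_of_multiset (mset_set (D_minus n))"
  define F where "F = ({..<length ns} \<rightarrow>\<^sub>E {1..d})"
  define G where "G = ({..<length ms} \<rightarrow>\<^sub>E {1..d})"
  define a where "a = (\<lambda>f. \<Prod>i<length ns. \<alpha> (f i) ^ (ns ! i))"
  define b where "b = (\<lambda>g. \<Prod>i<length ms. \<alpha> (g i) ^ (ms ! i))"
  have fin: "finite F" "finite G" by (auto simp: F_def G_def intro: finite_PiE)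
  have finD: "finite (D_plus n)" "finite (D_minus n)"
    using assms(6) by (auto simp: D_plus_def D_minus_def)
  have U: "U d \<alpha> n = (\<Prod>(f, g)\<in>F \<times> G. a f - b g)"
    using monic_resultant_prod_linear[OF fin, of a b]
    by (simp add: U_def power_product_poly_def Let_def a_def b_def F_def G_def ns_def ms_def)

  \<comment> \<open>Rational power sums pass from the roots to \<open>a\<close> and
    \<open>b\<close>, then to all differences \<open>a f - b g\<close>, whose product is
    \<open>U d \<alpha> n\<close>.\<close>
  have "U d \<alpha> n \<in> \<rat>"
  proof -
    have sums: "(\<Sum>j\<in>{1..d}. \<alpha> j ^ l) \<in> \<rat>" for l
      by (rule power_sums_Rats) (simp_all only: finite_atLeastAtMost assms(4)[symmetric]
          coeff_map_poly of_int_0 Rats_of_int)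
    have "(\<Sum>f\<in>F. a f ^ l) \<in> \<rat>" "(\<Sum>g\<in>G. b g ^ l) \<in> \<rat>" for l
      using sums by (auto simp: F_def G_def a_def b_def intro!: power_sums_tuples_Rats)
    from power_sums_diff_Rats[OF this]
    show ?thesis
      unfolding U using fin by (intro prod_Rats_of_power_sums) (auto simp: case_prod_unfold)
  qed

  \<comment> \<open>Pairs of constant tuples, restricted to the index ranges so that they are
    extensional and lie in \<open>F \<times> G\<close>.\<close>
  define diag :: "nat \<Rightarrow> (nat \<Rightarrow> nat) \<times> (nat \<Rightarrow> nat)"
    where "diag = (\<lambda>j. (\<lambda>i\<in>{..<length ns}. j, \<lambda>i\<in>{..<length ms}. j))"
  have diag_sub: "diag ` {1..d} \<subseteq> F \<times> G"
    by (auto simp: diag_def F_def G_def split: if_splits)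
  have "inj_on diag {1..d}"
  proof (rule inj_onI)
    fix i j assume eq: "diag i = diag j"
    \<comment> \<open>Since \<mu>(1) = 1, the first tuple has at least one position, and its entry
      there recovers the index.\<close>
    have "n \<in> D_plus n"
      using assms(6) by (simp add: D_plus_def mobius_mu_eq_1_iff)
    then have pos: "length ns > 0"
      using finD by (auto simp: ns_def card_gt_0_iff)
    have "fst (diag i) 0 = fst (diag j) 0" by (simp only: eq)
    with pos show "i = j" by (simp add: diag_def)
  qed
  have diag: "a (fst (diag j)) - b (snd (diag j)) = of_int k * (\<alpha> j ^ (\<Sum>m\<in>D_minus n. m) * \<rho> j)"
    if "j \<in> {1..d}" for j
  proof -
    have "a (fst (diag j)) - b (snd (diag j)) = \<alpha> j ^ (\<Sum>m\<in>D_plus n. m) - \<alpha> j ^ (\<Sum>m\<in>D_minus n. m)"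
      using prod_power_nth_sorted[OF finD(1), of "\<alpha> j"] prod_power_nth_sorted[OF finD(2), of "\<alpha> j"]
      by (simp add: a_def b_def diag_def flip: ns_def ms_def del: sorted_list_of_mset_set)
    also have "\<dots> = \<alpha> j ^ (\<Sum>m\<in>D_minus n. m) * (\<alpha> j ^ totient n - 1)"
      using assms(6) by (simp add: totient_eq_sum_D power_add algebra_simps)
    finally show ?thesis using \<rho>(2)[OF that] by simp
  qed
  \<comment> \<open>What remains of the resultant once one factor \<open>k\<close> is removed from
    each of the \<open>d\<close> diagonal differences.\<close>
  define w where "w = (\<Prod>j\<in>{1..d}. \<alpha> j ^ (\<Sum>m\<in>D_minus n. m) * \<rho> j) *
    (\<Prod>(f, g)\<in>F \<times> G - diag ` {1..d}. a f - b g)"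
  have Uw: "U d \<alpha> n = of_int (k ^ d) * w"
  proof -
    have "U d \<alpha> n = (\<Prod>(f, g)\<in>diag ` {1..d}. a f - b g) * (\<Prod>(f, g)\<in>F \<times> G - diag ` {1..d}. a f - b g)"
      unfolding U using fin diag_sub by (subst prod.subset_diff[OF diag_sub]) (auto simp: mult.commute)
    also have "(\<Prod>(f, g)\<in>diag ` {1..d}. a f - b g) =
        (\<Prod>j\<in>{1..d}. of_int k * (\<alpha> j ^ (\<Sum>m\<in>D_minus n. m) * \<rho> j))"
      using diag \<open>inj_on diag {1..d}\<close> by (simp add: prod.reindex case_prod_unfold)
    also have "\<dots> = of_int (k ^ d) * (\<Prod>j\<in>{1..d}. \<alpha> j ^ (\<Sum>m\<in>D_minus n. m) * \<rho> j)"
      by (simp only: prod.distrib prod_constant) simp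
    finally show ?thesis by (simp add: w_def mult.assoc)
  qed
  have "algebraic_int w"
  proof -
    have "algebraic_int (a f)" if "f \<in> F" for f
      using that int by (auto simp: a_def F_def PiE_iff intro!: algebraic_int_prod algebraic_int_power)
    moreover have "algebraic_int (b g)" if "g \<in> G" for g
      using that int by (auto simp: b_def G_def PiE_iff intro!: algebraic_int_prod algebraic_int_power)
    ultimately show ?thesis
      unfolding w_def using int \<rho>(1)
      by (intro algebraic_int_mult algebraic_int_prod)
        (auto intro!: algebraic_int_mult algebraic_int_power algebraic_int_diff)
  qed
  show ?thesis
  \<comment> \<open>If \<open>k ^ d\<close> is 0, so is the resultant. Otherwise division by it
    shows that \<open>w\<close> is rational, and a rational algebraic integer is an integer.\<close>
  proof (cases "k ^ d = 0")
    case True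
    then show ?thesis using Uw by (intro exI[of _ 0]) (simp del: power_eq_0_iff)
  next
    case False
    then have "w = U d \<alpha> n / of_int (k ^ d)"
      unfolding Uw by (subst nonzero_mult_div_cancel_left) (simp_all del: of_int_power)
    then have "w \<in> \<rat>" using \<open>U d \<alpha> n \<in> \<rat>\<close> by simp
    with \<open>algebraic_int w\<close> have "w \<in> \<int>" by (rule rational_algebraic_int_is_int)
    then obtain v where "w = of_int v" by (elim Ints_cases)
    then show ?thesis using Uw by (intro exI[of _ "k ^ d * v"]) simp
  qed
qed

end
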